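(* Let $H_1$ and $H_2$ be vertex-disjoint graphs, and for each $i\in\{1,2\}$ let $x_i$ be a non-isolated vertex of $H_i$. Let $G$ be the graph obtained from $H_1$ and $H_2$ by identifying $x_1$ and $x_2$ into a single vertex $x$. Then $G$ is weak bicritical if and only if for some $i\in\{1,2\}$: (1) $H_i$ is critical, (2) $H_{3-i}$ is weak bicritical, and (3) $x_{3-i}$ is a critical vertex of $H_{3-i}$. Furthermore, if $G$ is weak bicritical, then $\gamma(G)=\gamma(H_1)+\gamma(H_2)-1$.
   Context: All graphs are finite, simple and undirected. $\gamma(G)$ denotes the domination number of $G$ (minimum size of a set $S\subseteq V(G)$ such that every vertex is in $S$ or adjacent to a vertex of $S$). Define $V^{0}(G)=\{v:\gamma(G-v)=\gamma(G)\}$, $V^{+}(G)=\{v:\gamma(G-v)>\gamma(G)\}$, $V^{-}(G)=\{v:\gamma(G-v)<\gamma(G)\}$. A vertex in $V^{-}(G)$ is critical; $G$ is critical if every vertex is critical. $G$ is weak bicritical if $V^{+}(G)=\emptyset$ and $G-v$ is critical for every $v\in V^{0}(G)$. *)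

theory Defs
  imports "Graph_Theory.Graph_Theory"
begin

text \<open>
  A finite simple undirected graph is a finite symmetric loop-free digraph without parallel arcs
  (locale \<open>pair_graph\<close>), each undirected edge \<open>uv\<close> being represented by the arcs
  \<open>(u, v)\<close> and \<open>(v, u)\<close>. The graph without vertices is allowed and has domination number 0.
\<close>

definition dominating_set :: "('a, 'b) pre_digraph \<Rightarrow> 'a set \<Rightarrow> bool" where
  "dominating_set G S \<longleftrightarrow>
     S \<subseteq> verts G \<and> (\<forall>v\<in>verts G. v \<in> S \<or> (\<exists>u\<in>S. u \<rightarrow>\<^bsub>G\<^esub> v))"

definition domination_number :: "('a, 'b) pre_digraph \<Rightarrow> nat" where
  "domination_number G = (LEAST k. \<exists>S. dominating_set G S \<and> card S = k)"

definition V_zero :: "('a, 'b) pre_digraph \<Rightarrow> 'a set" where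
  "V_zero G = {v \<in> verts G. domination_number (pre_digraph.del_vert G v) = domination_number G}"

definition V_plus :: "('a, 'b) pre_digraph \<Rightarrow> 'a set" where
  "V_plus G = {v \<in> verts G. domination_number (pre_digraph.del_vert G v) > domination_number G}"

definition V_minus :: "('a, 'b) pre_digraph \<Rightarrow> 'a set" where
  "V_minus G = {v \<in> verts G. domination_number (pre_digraph.del_vert G v) < domination_number G}"

definition critical :: "('a, 'b) pre_digraph \<Rightarrow> bool" where
  "critical G \<longleftrightarrow> (\<forall>v\<in>verts G. v \<in> V_minus G)"

definition weak_bicritical :: "('a, 'b) pre_digraph \<Rightarrow> bool" where
  "weak_bicritical G \<longleftrightarrow>
     V_plus G = {} \<and> (\<forall>v\<in>V_zero G. critical (pre_digraph.del_vert G v))"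

definition non_isolated :: "('a, 'b) pre_digraph \<Rightarrow> 'a \<Rightarrow> bool" where
  "non_isolated G v \<longleftrightarrow> v \<in> verts G \<and> (\<exists>u\<in>verts G. v \<rightarrow>\<^bsub>G\<^esub> u)"

text \<open>
  \<open>coalescence H1 x1 H2 x2 x\<close> is the union of \<open>H1\<close> and \<open>H2\<close> with \<open>x1\<close> and \<open>x2\<close> both renamed to
  \<open>x\<close>. This is the intended identification only if \<open>H1\<close> and \<open>H2\<close> are vertex-disjoint and \<open>x\<close> is
  not one of the remaining vertices; \<open>x = x1\<close> and \<open>x = x2\<close> are allowed.
\<close>

definition coalescence ::
  "'a pair_pre_digraph \<Rightarrow> 'a \<Rightarrow> 'a pair_pre_digraph \<Rightarrow> 'a \<Rightarrow> 'a \<Rightarrow> 'a pair_pre_digraph" where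
  "coalescence H1 x1 H2 x2 x =
     (let f = (\<lambda>v. if v = x1 \<or> v = x2 then x else v)
      in \<lparr> pverts = f ` (pverts H1 \<union> pverts H2),
           parcs = map_prod f f ` (parcs H1 \<union> parcs H2) \<rparr>)"

lemma pair_graph_coalescence:
  assumes "pair_graph H1" "pair_graph H2"
    and "pverts H1 \<inter> pverts H2 = {}"
    and "x1 \<in> pverts H1" "x2 \<in> pverts H2"
    and "x \<notin> (pverts H1 \<union> pverts H2) - {x1, x2}"
  shows "pair_graph (coalescence H1 x1 H2 x2 x)"
proof -
  interpret H1: pair_graph H1 by fact
  interpret H2: pair_graph H2 by fact
  define f where "f = (\<lambda>v. if v = x1 \<or> v = x2 then x else v)"
  let ?G = "coalescence H1 x1 H2 x2 x"
  have V: "pverts ?G = f ` (pverts H1 \<union> pverts H2)"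
    and A: "parcs ?G = map_prod f f ` (parcs H1 \<union> parcs H2)"
    by (simp_all add: coalescence_def f_def Let_def)
  have s1: "(v, u) \<in> parcs H1" if "(u, v) \<in> parcs H1" for u v
    using H1.graph_symmetric that by simp
  have s2: "(v, u) \<in> parcs H2" if "(u, v) \<in> parcs H2" for u v
    using H2.graph_symmetric that by simp
  have w1: "u \<in> pverts H1 \<and> v \<in> pverts H1 \<and> u \<noteq> v" if "(u, v) \<in> parcs H1" for u v
    using H1.in_arcsD1[OF that] H1.in_arcsD2[OF that] H1.pair_no_loops[OF that] by simp
  have w2: "u \<in> pverts H2 \<and> v \<in> pverts H2 \<and> u \<noteq> v" if "(u, v) \<in> parcs H2" for u v
    using H2.in_arcsD1[OF that] H2.in_arcsD2[OF that] H2.pair_no_loops[OF that] by simp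
  have n1: "f u \<noteq> f v" if "(u, v) \<in> parcs H1" for u v
    using w1[OF that] assms by (auto simp: f_def)
  have n2: "f u \<noteq> f v" if "(u, v) \<in> parcs H2" for u v
    using w2[OF that] assms by (auto simp: f_def)
  show ?thesis
  proof unfold_locales
    show "finite (pverts ?G)" unfolding V by simp
    show "finite (parcs ?G)" unfolding A by simp
    show "fst e \<in> pverts ?G" if "e \<in> parcs ?G" for e
      using that w1 w2 unfolding V A by fastforce
    show "snd e \<in> pverts ?G" if "e \<in> parcs ?G" for e
      using that w1 w2 unfolding V A by fastforce
    show "fst e \<noteq> snd e" if "e \<in> parcs ?G" for e
      using that n1 n2 unfolding A by fastforce
    have "sym (parcs ?G)"
      unfolding A by (rule symI) (use s1 s2 in fastforce)
    then show "symmetric (with_proj ?G)"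
      by (simp add: symmetric_def)
  qed
qed

end

theory Submission
  imports Defs
begin

text \<open>
  Write \<open>\<gamma>\<close>, \<open>\<gamma>\<^sub>1\<close>, \<open>\<gamma>\<^sub>2\<close> for the domination numbers of \<open>G\<close>, \<open>H\<^sub>1\<close>, \<open>H\<^sub>2\<close>. Always
  \<open>\<gamma>\<^sub>1 + \<gamma>\<^sub>2 - 1 \<le> \<gamma>\<close>, \<open>\<gamma> \<le> \<gamma>\<^sub>1 + \<gamma>(H\<^sub>2 - x)\<close>, \<open>\<gamma> \<le> \<gamma>(H\<^sub>1 - x) + \<gamma>\<^sub>2\<close> and
  \<open>\<gamma>(G - x) = \<gamma>(H\<^sub>1 - x) + \<gamma>(H\<^sub>2 - x)\<close>. Hence \<open>x\<close> is critical in \<open>G\<close> iff it is critical in both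
  parts; in this case \<open>\<gamma> = \<gamma>\<^sub>1 + \<gamma>\<^sub>2 - 1\<close> and deleting a vertex \<open>v \<noteq> x\<close> of one part changes \<open>\<gamma>\<close> by
  as much as it changes the domination number of that part. Applied to \<open>G\<close> and to \<open>G - v\<close>, this
  gives the equivalence as soon as \<open>x\<close> is critical in \<open>G\<close>. If \<open>G\<close> is weak bicritical and \<open>x\<close> is not
  critical, then \<open>\<gamma>(G - x) = \<gamma>\<close> and both parts of \<open>G - x\<close> are critical; for neighbours \<open>y\<^sub>i\<close> of \<open>x\<close>
  in \<open>H\<^sub>i\<close>, dominating sets of \<open>H\<^sub>i - x - y\<^sub>i\<close> of size \<open>\<gamma>(H\<^sub>i - x) - 1\<close> together with \<open>x\<close> dominate
  \<open>G\<close> with \<open>\<gamma> - 1\<close> vertices, a contradiction.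
\<close>

section \<open>Domination in induced subgraphs\<close>

text \<open>
  The relation \<open>E\<close> is not restricted to \<open>V\<close>: the pair \<open>E\<close>, \<open>V\<close> stands for the subgraph induced
  by \<open>V\<close>, so that deleting a vertex only changes \<open>V\<close>.
\<close>

definition dominates_on :: "('a \<times> 'a) set \<Rightarrow> 'a set \<Rightarrow> 'a set \<Rightarrow> bool" where
  "dominates_on E V S \<longleftrightarrow> S \<subseteq> V \<and> (\<forall>v\<in>V. v \<in> S \<or> (\<exists>u\<in>S. (u, v) \<in> E))"

definition dom_num :: "('a \<times> 'a) set \<Rightarrow> 'a set \<Rightarrow> nat" where
  "dom_num E V = (LEAST k. \<exists>S. dominates_on E V S \<and> card S = k)"

definition critical_on :: "('a \<times> 'a) set \<Rightarrow> 'a set \<Rightarrow> bool" where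
  "critical_on E V \<longleftrightarrow> (\<forall>v\<in>V. dom_num E (V - {v}) < dom_num E V)"

definition weak_bicritical_on :: "('a \<times> 'a) set \<Rightarrow> 'a set \<Rightarrow> bool" where
  "weak_bicritical_on E V \<longleftrightarrow>
     (\<forall>v\<in>V. dom_num E (V - {v}) \<le> dom_num E V) \<and>
     (\<forall>v\<in>V. dom_num E (V - {v}) = dom_num E V \<longrightarrow> critical_on E (V - {v}))"

section \<open>Minimum dominating sets and their dependence on the induced relation\<close>

lemma dom_num_le: "dominates_on E V S \<Longrightarrow> dom_num E V \<le> card S"
  unfolding dom_num_def by (rule Least_le) blast

lemma dom_num_attained:
  obtains S where "dominates_on E V S" "card S = dom_num E V"
proof -
  have "dominates_on E V V" by (simp add: dominates_on_def)
  then have "\<exists>k S. dominates_on E V S \<and> card S = k" by blast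
  then have "\<exists>S. dominates_on E V S \<and> card S = dom_num E V"
    unfolding dom_num_def by (rule LeastI_ex)
  with that show thesis by blast
qed

lemma dom_num_cong:
  assumes "\<And>u v. u \<in> V \<Longrightarrow> v \<in> V \<Longrightarrow> (u, v) \<in> E \<longleftrightarrow> (u, v) \<in> E'"
  shows "dom_num E V = dom_num E' V"
proof -
  have "dominates_on E V = dominates_on E' V"
    using assms by (fastforce simp: dominates_on_def fun_eq_iff)
  then show ?thesis by (simp add: dom_num_def)
qed

text \<open>Deleting a vertex from a digraph also deletes its arcs, while \<open>E\<close> stays
  fixed here. The two views agree on the remaining vertices, which is all that counts.\<close>

lemma critical_on_cong:
  assumes "\<And>u v. u \<in> V \<Longrightarrow> v \<in> V \<Longrightarrow> (u, v) \<in> E \<longleftrightarrow> (u, v) \<in> E'"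
  shows "critical_on E V \<longleftrightarrow> critical_on E' V"
proof -
  have "dom_num E W = dom_num E' W" if "W \<subseteq> V" for W
    using that assms by (intro dom_num_cong) auto
  then show ?thesis by (simp add: critical_on_def)
qed

section \<open>Invariance under isomorphisms of induced subgraphs\<close>

lemma dom_num_image:
  assumes inj: "inj_on f V"
    and E: "\<And>u v. u \<in> V \<Longrightarrow> v \<in> V \<Longrightarrow> (f u, f v) \<in> E' \<longleftrightarrow> (u, v) \<in> E"
  shows "dom_num E' (f ` V) = dom_num E V"
proof -
  have dom: "dominates_on E' (f ` V) (f ` S) \<longleftrightarrow> dominates_on E V S" if "S \<subseteq> V" for S
  proof -
    have "f v \<in> f ` S \<longleftrightarrow> v \<in> S" if "v \<in> V" for v
      using inj that \<open>S \<subseteq> V\<close> by (rule inj_on_image_mem_iff)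
    moreover have "(\<exists>u\<in>S. (f u, f v) \<in> E') \<longleftrightarrow> (\<exists>u\<in>S. (u, v) \<in> E)" if "v \<in> V" for v
      using E \<open>S \<subseteq> V\<close> that by blast
    ultimately show ?thesis using that by (auto simp: dominates_on_def)
  qed
  have card: "card (f ` S) = card S" if "S \<subseteq> V" for S
    using inj that by (intro card_image) (rule inj_on_subset)
  have "(\<exists>T. dominates_on E' (f ` V) T \<and> card T = k) \<longleftrightarrow> (\<exists>S. dominates_on E V S \<and> card S = k)"
    for k
  proof
    assume "\<exists>T. dominates_on E' (f ` V) T \<and> card T = k"
    then obtain T where T: "dominates_on E' (f ` V) T" "card T = k" by blast
    then obtain S where "S \<subseteq> V" "T = f ` S"
      by (auto simp: dominates_on_def elim: subset_imageE)
    with T dom card show "\<exists>S. dominates_on E V S \<and> card S = k" by auto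
  next
    assume "\<exists>S. dominates_on E V S \<and> card S = k"
    then obtain S where S: "dominates_on E V S" "card S = k" by blast
    then have "S \<subseteq> V" by (simp add: dominates_on_def)
    with S dom card show "\<exists>T. dominates_on E' (f ` V) T \<and> card T = k" by blast
  qed
  then show ?thesis by (simp add: dom_num_def)
qed

lemma dom_num_image_delete:
  assumes "inj_on f V"
    and "\<And>u v. u \<in> V \<Longrightarrow> v \<in> V \<Longrightarrow> (f u, f v) \<in> E' \<longleftrightarrow> (u, v) \<in> E"
    and "v \<in> V"
  shows "dom_num E' (f ` V - {f v}) = dom_num E (V - {v})"
proof -
  have "f ` V - {f v} = f ` (V - {v})"
    using assms(1,3) by (auto simp: inj_on_def)
  then show ?thesis
    using dom_num_image[of f "V - {v}" E' E] assms by (simp add: inj_on_diff)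
qed

lemma critical_on_image:
  assumes "inj_on f V"
    and "\<And>u v. u \<in> V \<Longrightarrow> v \<in> V \<Longrightarrow> (f u, f v) \<in> E' \<longleftrightarrow> (u, v) \<in> E"
  shows "critical_on E' (f ` V) \<longleftrightarrow> critical_on E V"
  unfolding critical_on_def
  using dom_num_image[OF assms] dom_num_image_delete[OF assms] by simp

lemma weak_bicritical_on_image:
  assumes "inj_on f V"
    and "\<And>u v. u \<in> V \<Longrightarrow> v \<in> V \<Longrightarrow> (f u, f v) \<in> E' \<longleftrightarrow> (u, v) \<in> E"
  shows "weak_bicritical_on E' (f ` V) \<longleftrightarrow> weak_bicritical_on E V"
proof -
  have "critical_on E' (f ` V - {f v}) \<longleftrightarrow> critical_on E (V - {v})" if "v \<in> V" for v
  proof -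
    have "f ` V - {f v} = f ` (V - {v})"
      using assms(1) that by (auto simp: inj_on_def)
    then show ?thesis
      using critical_on_image[of f "V - {v}" E' E] assms by (simp add: inj_on_diff)
  qed
  then show ?thesis
    unfolding weak_bicritical_on_def
    using dom_num_image[OF assms] dom_num_image_delete[OF assms] by simp
qed

section \<open>Disjoint unions without edges between the parts\<close>

lemma dom_num_disjoint_Un:
  assumes fin: "finite A" "finite B" and disj: "A \<inter> B = {}"
    and sep: "\<And>u v. u \<in> A \<Longrightarrow> v \<in> B \<Longrightarrow> (u, v) \<notin> E \<and> (v, u) \<notin> E"
  shows "dom_num E (A \<union> B) = dom_num E A + dom_num E B"
proof (rule antisym)
  obtain S where S: "dominates_on E A S" "card S = dom_num E A" by (rule dom_num_attained)
  obtain T where T: "dominates_on E B T" "card T = dom_num E B" by (rule dom_num_attained)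
  have "dominates_on E (A \<union> B) (S \<union> T)"
    using S(1) T(1) by (auto simp: dominates_on_def)
  from dom_num_le[OF this] show "dom_num E (A \<union> B) \<le> dom_num E A + dom_num E B"
    using card_Un_le[of S T] S(2) T(2) by linarith
next
  obtain S where S: "dominates_on E (A \<union> B) S" "card S = dom_num E (A \<union> B)"
    by (rule dom_num_attained)
  \<comment> \<open>No edge crosses, so every vertex is dominated from its own part.\<close>
  have "dominates_on E A (S \<inter> A)" "dominates_on E B (S \<inter> B)"
    using S(1) sep unfolding dominates_on_def by blast+
  then have "dom_num E A \<le> card (S \<inter> A)" "dom_num E B \<le> card (S \<inter> B)"
    by (simp_all add: dom_num_le)
  moreover have "card (S \<inter> A) + card (S \<inter> B) = card S"
  proof -
    have "S = (S \<inter> A) \<union> (S \<inter> B)" using S(1) by (auto simp: dominates_on_def)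
    moreover have "card ((S \<inter> A) \<union> (S \<inter> B)) = card (S \<inter> A) + card (S \<inter> B)"
      using fin disj by (intro card_Un_disjoint) auto
    ultimately show ?thesis by simp
  qed
  ultimately show "dom_num E A + dom_num E B \<le> dom_num E (A \<union> B)"
    using S(2) by linarith
qed

text \<open>Deleting a vertex of \<open>A\<close> leaves the summand contributed by \<open>B\<close>
  unchanged, so the strict decrease takes place in \<open>A\<close>.\<close>

lemma critical_on_disjoint_Un_left:
  assumes fin: "finite A" "finite B" and disj: "A \<inter> B = {}"
    and sep: "\<And>u v. u \<in> A \<Longrightarrow> v \<in> B \<Longrightarrow> (u, v) \<notin> E \<and> (v, u) \<notin> E"
    and crit: "critical_on E (A \<union> B)"
  shows "critical_on E A"
  unfolding critical_on_def
proof
  fix v assume v: "v \<in> A"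
  then have "A \<union> B - {v} = (A - {v}) \<union> B" using disj by auto
  moreover have "dom_num E ((A - {v}) \<union> B) = dom_num E (A - {v}) + dom_num E B"
    using fin disj sep by (intro dom_num_disjoint_Un) auto
  moreover have "dom_num E (A \<union> B - {v}) < dom_num E (A \<union> B)"
    using crit v by (simp add: critical_on_def)
  ultimately show "dom_num E (A - {v}) < dom_num E A"
    using dom_num_disjoint_Un[OF fin disj sep] by simp
qed

section \<open>Graphs glued at a vertex\<close>

locale one_point_union =
  fixes E :: "('a \<times> 'a) set" and V1 V2 :: "'a set" and x :: 'a
  assumes fin: "finite V1" "finite V2"
    and Int: "V1 \<inter> V2 = {x}"
    and sep: "\<And>u v. u \<in> V1 - {x} \<Longrightarrow> v \<in> V2 - {x} \<Longrightarrow> (u, v) \<notin> E \<and> (v, u) \<notin> E"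
begin

lemma x_mem: "x \<in> V1" "x \<in> V2"
  using Int by auto

lemma commute: "one_point_union E V2 V1 x"
  using fin Int sep by unfold_locales auto

lemma delete_left: "v \<noteq> x \<Longrightarrow> one_point_union E (V1 - {v}) V2 x"
  using fin Int sep by unfold_locales auto

lemma Un_delete: "v \<in> V1 \<Longrightarrow> v \<noteq> x \<Longrightarrow> V1 \<union> V2 - {v} = (V1 - {v}) \<union> V2"
  using Int by auto

lemma Un_delete_x: "V1 \<union> V2 - {x} = (V1 - {x}) \<union> (V2 - {x})"
  by auto

section \<open>Domination numbers of a one-point union\<close>

lemma dom_num_delete_x:
  "dom_num E (V1 \<union> V2 - {x}) = dom_num E (V1 - {x}) + dom_num E (V2 - {x})"
  unfolding Un_delete_x using fin Int sep by (intro dom_num_disjoint_Un) auto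

lemma dom_num_Un_le: "dom_num E (V1 \<union> V2) \<le> dom_num E V1 + dom_num E (V2 - {x})"
proof -
  obtain S where S: "dominates_on E V1 S" "card S = dom_num E V1" by (rule dom_num_attained)
  obtain T where T: "dominates_on E (V2 - {x}) T" "card T = dom_num E (V2 - {x})"
    by (rule dom_num_attained)
  have "dominates_on E (V1 \<union> V2) (S \<union> T)"
    using S(1) T(1) x_mem unfolding dominates_on_def by blast
  from dom_num_le[OF this] show ?thesis
    using card_Un_le[of S T] S(2) T(2) by linarith
qed

text \<open>The vertex \<open>u\<close> dominates \<open>x\<close> from within \<open>V1\<close>, so
  \<open>S\<close> restricted to \<open>V1\<close> dominates \<open>V1\<close>. On the other side
  \<open>x\<close> may have lost its dominator, and edges from \<open>V1\<close> reach
  \<open>V2\<close> only through \<open>x\<close>; adding \<open>x\<close> itself repairs this at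
  the cost of one vertex.\<close>

lemma dom_num_le_Un_aux:
  assumes S: "dominates_on E (V1 \<union> V2) S" and u: "u \<in> S \<inter> V1" "u = x \<or> (u, x) \<in> E"
  shows "dom_num E V1 + dom_num E V2 \<le> Suc (card S)"
proof -
  have fS: "finite S" using S fin by (auto simp: dominates_on_def intro: finite_subset)
  have "dominates_on E V1 (S \<inter> V1)"
    unfolding dominates_on_def
  proof (intro conjI ballI)
    fix v assume v: "v \<in> V1"
    show "v \<in> S \<inter> V1 \<or> (\<exists>w\<in>S \<inter> V1. (w, v) \<in> E)"
    proof (cases "v = x")
      case True
      then show ?thesis using u v by blast
    next
      case False
      have "v \<in> S \<or> (\<exists>w\<in>S. (w, v) \<in> E)" and "S \<subseteq> V1 \<union> V2"
        using S v by (auto simp: dominates_on_def)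
      then show ?thesis using sep[of v] v False x_mem by blast
    qed
  qed blast
  then have 1: "dom_num E V1 \<le> card (S \<inter> V1)" by (rule dom_num_le)
  have "dominates_on E V2 (insert x (S \<inter> V2))"
    unfolding dominates_on_def
  proof (intro conjI ballI)
    fix v assume v: "v \<in> V2"
    have "v \<in> S \<or> (\<exists>w\<in>S. (w, v) \<in> E)" and "S \<subseteq> V1 \<union> V2"
      using S v by (auto simp: dominates_on_def)
    then show "v \<in> insert x (S \<inter> V2) \<or> (\<exists>w\<in>insert x (S \<inter> V2). (w, v) \<in> E)"
      using sep[of _ v] v by blast
  qed (use x_mem in auto)
  \<comment> \<open>Rewriting with \<open>S - V1\<close> keeps \<open>x\<close> from being counted
    in both parts when it belongs to \<open>S\<close>.\<close>
  moreover have "insert x (S \<inter> V2) = insert x (S - V1)"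
    using S Int by (auto simp: dominates_on_def)
  ultimately have "dom_num E V2 \<le> card (insert x (S - V1))"
    by (metis dom_num_le)
  also have "\<dots> \<le> Suc (card (S - V1))"
    using fS by (simp add: card_insert_if)
  finally have 2: "dom_num E V2 \<le> Suc (card (S - V1))" .
  have "card S = card (S \<inter> V1) + card (S - V1)"
    using fS by (rule card_Int_Diff)
  with 1 2 show ?thesis by linarith
qed

lemma dom_num_le_Un: "dom_num E V1 + dom_num E V2 \<le> Suc (dom_num E (V1 \<union> V2))"
proof -
  interpret c: one_point_union E V2 V1 x by (rule commute)
  obtain S where S: "dominates_on E (V1 \<union> V2) S" "card S = dom_num E (V1 \<union> V2)"
    by (rule dom_num_attained)
  \<comment> \<open>Whatever dominates \<open>x\<close> lies in one of the two parts, and that part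
    takes the role of \<open>V1\<close> in the auxiliary bound.\<close>
  then obtain u where u: "u \<in> S" "u = x \<or> (u, x) \<in> E"
    using x_mem unfolding dominates_on_def by blast
  from S(1) u(1) have "u \<in> V1 \<or> u \<in> V2" by (auto simp: dominates_on_def)
  then show ?thesis
  proof
    assume "u \<in> V1"
    then show ?thesis using dom_num_le_Un_aux[OF S(1)] u S(2) by simp
  next
    assume "u \<in> V2"
    then show ?thesis using c.dom_num_le_Un_aux[of S] u S by (simp add: Un_commute add.commute)
  qed
qed

text \<open>Criticality of \<open>x\<close> in \<open>V2\<close> lowers the upper bound by one, so
  that it meets the lower bound.\<close>

lemma dom_num_Un_eq:
  assumes "dom_num E (V2 - {x}) < dom_num E V2"
  shows "Suc (dom_num E (V1 \<union> V2)) = dom_num E V1 + dom_num E V2"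
  using dom_num_Un_le dom_num_le_Un assms by linarith

lemma dom_num_delete_eq:
  assumes "dom_num E (V2 - {x}) < dom_num E V2" "v \<in> V1" "v \<noteq> x"
  shows "Suc (dom_num E (V1 \<union> V2 - {v})) = dom_num E (V1 - {v}) + dom_num E V2"
  using one_point_union.dom_num_Un_eq[OF delete_left[OF assms(3)] assms(1)]
  by (simp add: Un_delete[OF assms(2,3)])

text \<open>Forwards, each of the two upper bounds shares one summand with the number for the union
  without \<open>x\<close>; cancelling it leaves the inequality for the other part. Backwards, the
  two decrements outweigh the loss of one in the lower bound.\<close>

lemma critical_x_iff:
  "dom_num E (V1 \<union> V2 - {x}) < dom_num E (V1 \<union> V2) \<longleftrightarrow>
     dom_num E (V1 - {x}) < dom_num E V1 \<and> dom_num E (V2 - {x}) < dom_num E V2"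
  using dom_num_Un_le one_point_union.dom_num_Un_le[OF commute] dom_num_le_Un
  unfolding dom_num_delete_x by (auto simp: Un_commute)

section \<open>Criticality and weak bicriticality of a one-point union\<close>

lemma critical_on_Un_iff: "critical_on E (V1 \<union> V2) \<longleftrightarrow> critical_on E V1 \<and> critical_on E V2"
proof -
  interpret c: one_point_union E V2 V1 x by (rule commute)
  show ?thesis
  \<comment> \<open>If \<open>x\<close> is critical in both parts, deleting any other vertex shifts
    the numbers of its part and of the union equally. If not, both sides of the equivalence already
    fail at \<open>x\<close>.\<close>
  proof (cases "dom_num E (V1 - {x}) < dom_num E V1 \<and> dom_num E (V2 - {x}) < dom_num E V2")
    case True
    have 1: "dom_num E (V1 \<union> V2 - {v}) < dom_num E (V1 \<union> V2) \<longleftrightarrow>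
        dom_num E (V1 - {v}) < dom_num E V1" if "v \<in> V1" "v \<noteq> x" for v
      using dom_num_delete_eq[of v] dom_num_Un_eq True that by linarith
    have 2: "dom_num E (V1 \<union> V2 - {v}) < dom_num E (V1 \<union> V2) \<longleftrightarrow>
        dom_num E (V2 - {v}) < dom_num E V2" if "v \<in> V2" "v \<noteq> x" for v
      using c.dom_num_delete_eq[of v] c.dom_num_Un_eq True that
      unfolding Un_commute[of V2 V1] by linarith
    show ?thesis
      using 1 2 True critical_x_iff unfolding critical_on_def by blast
  next
    case False
    then show ?thesis
      using critical_x_iff x_mem unfolding critical_on_def by blast
  qed
qed

text \<open>A vertex \<open>v\<close> of \<open>V1\<close> whose deletion keeps the number of
  \<open>V1\<close> also keeps that of the union. The union without \<open>v\<close> is then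
  critical, hence so are both of its parts \<open>V1 - {v}\<close> and \<open>V2\<close>. Thus one
  non-critical vertex in \<open>V1\<close> forces \<open>V2\<close> to be critical.\<close>

lemma weak_bicritical_on_Un_left:
  assumes x1: "dom_num E (V1 - {x}) < dom_num E V1"
    and x2: "dom_num E (V2 - {x}) < dom_num E V2"
    and wb: "weak_bicritical_on E (V1 \<union> V2)"
  shows "weak_bicritical_on E V1 \<and> (critical_on E V1 \<or> critical_on E V2)"
proof -
  have le: "dom_num E (V1 - {v}) \<le> dom_num E V1" if "v \<in> V1" for v
  proof (cases "v = x")
    case True
    then show ?thesis using x1 by simp
  next
    case False
    then have "dom_num E (V1 \<union> V2 - {v}) \<le> dom_num E (V1 \<union> V2)"
      using wb that by (simp add: weak_bicritical_on_def)
    then show ?thesis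
      using dom_num_delete_eq[OF x2 that False] dom_num_Un_eq[OF x2] by linarith
  qed
  have crit: "critical_on E (V1 - {v}) \<and> critical_on E V2"
    if v: "v \<in> V1" and eq: "dom_num E (V1 - {v}) = dom_num E V1" for v
  proof -
    have "v \<noteq> x" using x1 eq by auto
    then have "dom_num E (V1 \<union> V2 - {v}) = dom_num E (V1 \<union> V2)"
      using dom_num_delete_eq[OF x2 v] dom_num_Un_eq[OF x2] eq by linarith
    then have "critical_on E (V1 \<union> V2 - {v})"
      using wb v by (simp add: weak_bicritical_on_def)
    then show ?thesis
      using one_point_union.critical_on_Un_iff[OF delete_left[OF \<open>v \<noteq> x\<close>]]
        Un_delete[OF v \<open>v \<noteq> x\<close>] by simp
  qed
  have "critical_on E V1" if "\<not> critical_on E V2"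
    unfolding critical_on_def using le crit that by (blast intro: le_neq_implies_less)
  then show ?thesis
    using le crit by (auto simp: weak_bicritical_on_def)
qed

lemma weak_bicritical_on_UnI:
  assumes crit: "critical_on E V1" and wb: "weak_bicritical_on E V2"
    and x2: "dom_num E (V2 - {x}) < dom_num E V2"
  shows "weak_bicritical_on E (V1 \<union> V2)"
proof -
  interpret c: one_point_union E V2 V1 x by (rule commute)
  have x1: "dom_num E (V1 - {x}) < dom_num E V1"
    using crit x_mem by (simp add: critical_on_def)
  have less: "dom_num E (V1 \<union> V2 - {v}) < dom_num E (V1 \<union> V2)" if "v \<in> V1" for v
  proof (cases "v = x")
    case True
    then show ?thesis using critical_x_iff x1 x2 by simp
  next
    case False
    have "dom_num E (V1 - {v}) < dom_num E V1"
      using crit that by (simp add: critical_on_def)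
    then show ?thesis
      using dom_num_delete_eq[OF x2 that False] dom_num_Un_eq[OF x2] by linarith
  qed
  have right: "dom_num E (V1 \<union> V2 - {v}) \<le> dom_num E (V1 \<union> V2) \<and>
      (dom_num E (V1 \<union> V2 - {v}) = dom_num E (V1 \<union> V2) \<longrightarrow> critical_on E (V1 \<union> V2 - {v}))"
    if v: "v \<in> V2" "v \<noteq> x" for v
  proof -
    have "Suc (dom_num E (V1 \<union> V2 - {v})) = dom_num E (V2 - {v}) + dom_num E V1"
      using c.dom_num_delete_eq[OF x1 v] by (simp add: Un_commute)
    \<comment> \<open>Deletion of \<open>v\<close> changes the union and \<open>V2\<close> by the
      same amount, stated without subtraction on naturals.\<close>
    then have *: "dom_num E (V1 \<union> V2 - {v}) + dom_num E V2 =
        dom_num E (V2 - {v}) + dom_num E (V1 \<union> V2)"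
      using dom_num_Un_eq[OF x2] by linarith
    have "critical_on E (V1 \<union> V2 - {v}) \<longleftrightarrow> critical_on E (V2 - {v}) \<and> critical_on E V1"
      using one_point_union.critical_on_Un_iff[OF c.delete_left[OF v(2)]] c.Un_delete[OF v]
      by (simp add: Un_commute)
    moreover have "dom_num E (V2 - {v}) \<le> dom_num E V2"
      "dom_num E (V2 - {v}) = dom_num E V2 \<Longrightarrow> critical_on E (V2 - {v})"
      using wb v by (simp_all add: weak_bicritical_on_def)
    ultimately show ?thesis using * crit by simp
  qed
  have "dom_num E (V1 \<union> V2 - {v}) \<le> dom_num E (V1 \<union> V2) \<and>
      (dom_num E (V1 \<union> V2 - {v}) = dom_num E (V1 \<union> V2) \<longrightarrow> critical_on E (V1 \<union> V2 - {v}))"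
    if "v \<in> V1 \<union> V2" for v
  proof (cases "v \<in> V1")
    case True
    then show ?thesis using less[OF True] by simp
  next
    case False
    with that have "v \<in> V2" "v \<noteq> x" using x_mem by auto
    then show ?thesis by (rule right)
  qed
  then show ?thesis unfolding weak_bicritical_on_def by blast
qed

lemma critical_x_if_weak_bicritical_on:
  assumes y1: "y1 \<in> V1" "y1 \<noteq> x" "(x, y1) \<in> E" and y2: "y2 \<in> V2" "y2 \<noteq> x" "(x, y2) \<in> E"
    and wb: "weak_bicritical_on E (V1 \<union> V2)"
  shows "dom_num E (V1 \<union> V2 - {x}) < dom_num E (V1 \<union> V2)"
proof (rule ccontr)
  assume "\<not> ?thesis"
  then have eq: "dom_num E (V1 \<union> V2 - {x}) = dom_num E (V1 \<union> V2)"
    using wb x_mem by (simp add: weak_bicritical_on_def order.antisym)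
  then have crit: "critical_on E ((V1 - {x}) \<union> (V2 - {x}))"
    using wb x_mem unfolding weak_bicritical_on_def Un_delete_x[symmetric] by blast
  have "critical_on E (V1 - {x})"
    by (rule critical_on_disjoint_Un_left[OF _ _ _ _ crit]) (use fin Int sep in auto)
  then have less1: "dom_num E (V1 - {x} - {y1}) < dom_num E (V1 - {x})"
    using y1 by (simp add: critical_on_def)
  have "critical_on E (V2 - {x})"
    \<comment> \<open>The sides are exchanged: \<open>V1 - {x}\<close> is now the summand split
      off.\<close>
    by (rule critical_on_disjoint_Un_left[of _ "V1 - {x}"])
      (use fin Int sep crit in \<open>auto simp: Un_commute\<close>)
  then have less2: "dom_num E (V2 - {x} - {y2}) < dom_num E (V2 - {x})"
    using y2 by (simp add: critical_on_def)
  obtain S where S: "dominates_on E (V1 - {x} - {y1}) S" "card S = dom_num E (V1 - {x} - {y1})"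
    by (rule dom_num_attained)
  obtain T where T: "dominates_on E (V2 - {x} - {y2}) T" "card T = dom_num E (V2 - {x} - {y2})"
    by (rule dom_num_attained)
  \<comment> \<open>The vertices \<open>y1\<close> and \<open>y2\<close>, missed by \<open>S\<close>
    and \<open>T\<close>, are dominated by \<open>x\<close>.\<close>
  have "dominates_on E (V1 \<union> V2) (insert x (S \<union> T))"
    using S(1) T(1) x_mem y1 y2 unfolding dominates_on_def by blast
  then have "dom_num E (V1 \<union> V2) \<le> card (insert x (S \<union> T))" by (rule dom_num_le)
  also have "\<dots> \<le> Suc (card (S \<union> T))"
    using card_insert_le_m1[of "Suc (card (S \<union> T))" "S \<union> T" x] by simp
  also have "\<dots> \<le> Suc (card S + card T)"
    using card_Un_le[of S T] by simp
  \<comment> \<open>Two vertices are saved, one in each part, and only \<open>x\<close> is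
    added.\<close>
  also have "\<dots> < dom_num E (V1 - {x}) + dom_num E (V2 - {x})"
    using S(2) T(2) less1 less2 by linarith
  finally show False using eq dom_num_delete_x by simp
qed

theorem weak_bicritical_on_Un_iff:
  assumes y1: "y1 \<in> V1" "y1 \<noteq> x" "(x, y1) \<in> E" and y2: "y2 \<in> V2" "y2 \<noteq> x" "(x, y2) \<in> E"
  shows "weak_bicritical_on E (V1 \<union> V2) \<longleftrightarrow>
      (critical_on E V1 \<and> weak_bicritical_on E V2 \<and> dom_num E (V2 - {x}) < dom_num E V2) \<or>
      (critical_on E V2 \<and> weak_bicritical_on E V1 \<and> dom_num E (V1 - {x}) < dom_num E V1)"
    (is "?G \<longleftrightarrow> ?H")
    and "weak_bicritical_on E (V1 \<union> V2) \<Longrightarrow>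
      Suc (dom_num E (V1 \<union> V2)) = dom_num E V1 + dom_num E V2"
proof -
  interpret c: one_point_union E V2 V1 x by (rule commute)
  have x: "dom_num E (V1 - {x}) < dom_num E V1" "dom_num E (V2 - {x}) < dom_num E V2" if ?G
    using critical_x_if_weak_bicritical_on[OF y1 y2 that] critical_x_iff by simp_all
  show "?G \<longleftrightarrow> ?H"
  proof
    assume G: ?G
    show ?H
      \<comment> \<open>Both parts come out weak bicritical and at least one of them critical;
        criticality of \<open>x\<close> in both supplies the last condition.\<close>
      using weak_bicritical_on_Un_left[OF x[OF G] G]
        c.weak_bicritical_on_Un_left[OF x(2)[OF G] x(1)[OF G]] x[OF G] G by (auto simp: Un_commute)
  next
    assume ?H
    then show ?G
      using weak_bicritical_on_UnI c.weak_bicritical_on_UnI by (auto simp: Un_commute)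
  qed
  show "Suc (dom_num E (V1 \<union> V2)) = dom_num E V1 + dom_num E V2" if ?G
    using x(2)[OF that] by (rule dom_num_Un_eq)
qed

end

section \<open>Transfer to digraphs\<close>

lemma domination_number_eq_dom_num: "domination_number G = dom_num (arcs_ends G) (verts G)"
  by (simp add: domination_number_def dom_num_def dominating_set_def dominates_on_def)

lemma in_arcs_ends_del_vert_iff:
  assumes "u \<noteq> v" "w \<noteq> v"
  shows "(u, w) \<in> arcs_ends (pre_digraph.del_vert G v) \<longleftrightarrow> (u, w) \<in> arcs_ends G"
  using assms by (auto simp: arcs_ends_def pre_digraph.del_vert_def arc_to_ends_def)

lemma domination_number_del_vert:
  "domination_number (pre_digraph.del_vert G v) = dom_num (arcs_ends G) (verts G - {v})"
  unfolding domination_number_eq_dom_num pre_digraph.verts_del_vert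
  by (rule dom_num_cong) (simp add: in_arcs_ends_del_vert_iff)

lemma V_minus_iff:
  "v \<in> V_minus G \<longleftrightarrow>
     v \<in> verts G \<and> dom_num (arcs_ends G) (verts G - {v}) < dom_num (arcs_ends G) (verts G)"
  by (simp add: V_minus_def domination_number_del_vert domination_number_eq_dom_num[of G])

lemma critical_iff_critical_on: "critical G \<longleftrightarrow> critical_on (arcs_ends G) (verts G)"
  by (simp add: critical_def critical_on_def V_minus_iff)

lemma weak_bicritical_iff_weak_bicritical_on:
  "weak_bicritical G \<longleftrightarrow> weak_bicritical_on (arcs_ends G) (verts G)"
proof -
  have "critical (pre_digraph.del_vert G v) \<longleftrightarrow> critical_on (arcs_ends G) (verts G - {v})" for v
    unfolding critical_iff_critical_on pre_digraph.verts_del_vert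
    by (rule critical_on_cong) (simp add: in_arcs_ends_del_vert_iff)
  then show ?thesis
    by (auto simp: weak_bicritical_def weak_bicritical_on_def V_plus_def V_zero_def
        domination_number_del_vert domination_number_eq_dom_num[of G] not_less)
qed

lemma arcs_ends_with_proj: "arcs_ends (with_proj H) = parcs H"
  by (auto simp: arcs_ends_def arc_to_ends_def)

theorem theorem2p1:
  fixes H1 H2 G :: "'a pair_pre_digraph" and x1 x2 x :: 'a
  assumes "pair_graph H1" and "pair_graph H2"
    and "pverts H1 \<inter> pverts H2 = {}"
    and "non_isolated (with_proj H1) x1" and "non_isolated (with_proj H2) x2"
    and "x \<notin> (pverts H1 \<union> pverts H2) - {x1, x2}"
    and "G = coalescence H1 x1 H2 x2 x"
  shows "(weak_bicritical (with_proj G) \<longleftrightarrow>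
            (critical (with_proj H1) \<and> weak_bicritical (with_proj H2)
               \<and> x2 \<in> V_minus (with_proj H2)) \<or>
            (critical (with_proj H2) \<and> weak_bicritical (with_proj H1)
               \<and> x1 \<in> V_minus (with_proj H1)))
         \<and> (weak_bicritical (with_proj G) \<longrightarrow>
            domination_number (with_proj G)
              = domination_number (with_proj H1) + domination_number (with_proj H2) - 1)"
proof -
  interpret H1: pair_graph H1 by fact
  interpret H2: pair_graph H2 by fact
  define f where "f = (\<lambda>v. if v = x1 \<or> v = x2 then x else v)"
  let ?E = "map_prod f f ` (parcs H1 \<union> parcs H2)"
  let ?V1 = "f ` pverts H1" and ?V2 = "f ` pverts H2"
  have V: "verts (with_proj G) = ?V1 \<union> ?V2" and A: "arcs_ends (with_proj G) = ?E"
    unfolding arcs_ends_with_proj assms(7)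
    by (simp_all add: coalescence_def f_def Let_def image_Un)
  have x12: "x1 \<in> pverts H1" "x2 \<in> pverts H2"
    using assms(4,5) by (simp_all add: non_isolated_def)
  have mem: "u \<in> pverts H \<and> v \<in> pverts H" if "(u, v) \<in> parcs H" "H = H1 \<or> H = H2" for u v H
    using that H1.in_arcsD1[of u v] H1.in_arcsD2[of u v] H2.in_arcsD1[of u v] H2.in_arcsD2[of u v]
    by auto
  \<comment> \<open>On each part \<open>f\<close> renames just one vertex, and its new name is taken
    by no other vertex. So each part is embedded isomorphically, although \<open>f\<close> may
    identify \<open>x1\<close> with \<open>x2\<close>.\<close>
  have inj: "inj_on f (pverts H1)" "inj_on f (pverts H2)"
    using assms(3,6) x12 by (auto simp: inj_on_def f_def)
  have fx: "f x1 = x" "f x2 = x" by (simp_all add: f_def)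
  have cross: "u = x1 \<and> v = x2" if "u \<in> pverts H1" "v \<in> pverts H2" "f u = f v" for u v
    using that assms(3,6) x12 by (auto simp: f_def split: if_splits)
  have E1: "(f u, f v) \<in> ?E \<longleftrightarrow> (u, v) \<in> parcs H1" if "u \<in> pverts H1" "v \<in> pverts H1" for u v
  proof
    assume "(f u, f v) \<in> ?E"
    then obtain u' v' where e: "(u', v') \<in> parcs H1 \<union> parcs H2" "f u = f u'" "f v = f v'" by auto
    show "(u, v) \<in> parcs H1"
    proof (cases "(u', v') \<in> parcs H1")
      case True
      then show ?thesis using e that mem[of u' v' H1] inj(1) by (auto simp: inj_on_def)
    next
      case False
      then have "(u', v') \<in> parcs H2" using e by simp
      \<comment> \<open>An arc of \<open>H2\<close> with both ends mapped into the image of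
        \<open>H1\<close> would have both ends equal to \<open>x2\<close>, hence be a loop.\<close>
      then have "u' = v'" using cross[of u u'] cross[of v v'] mem[of u' v' H2] that e by auto
      then show ?thesis using H2.pair_no_loops[of "(u', v')"] \<open>(u', v') \<in> parcs H2\<close> by simp
    qed
  qed force
  have E2: "(f u, f v) \<in> ?E \<longleftrightarrow> (u, v) \<in> parcs H2" if "u \<in> pverts H2" "v \<in> pverts H2" for u v
  proof
    assume "(f u, f v) \<in> ?E"
    then obtain u' v' where e: "(u', v') \<in> parcs H1 \<union> parcs H2" "f u = f u'" "f v = f v'" by auto
    show "(u, v) \<in> parcs H2"
    proof (cases "(u', v') \<in> parcs H2")
      case True
      then show ?thesis using e that mem[of u' v' H2] inj(2) by (auto simp: inj_on_def)
    next
      case False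
      then have "(u', v') \<in> parcs H1" using e by simp
      then have "u' = v'" using cross[of u' u] cross[of v' v] mem[of u' v' H1] that e by auto
      then show ?thesis using H1.pair_no_loops[of "(u', v')"] \<open>(u', v') \<in> parcs H1\<close> by simp
    qed
  qed force
  have Int: "?V1 \<inter> ?V2 = {x}"
  proof
    show "?V1 \<inter> ?V2 \<subseteq> {x}" using cross fx by blast
    show "{x} \<subseteq> ?V1 \<inter> ?V2" using x12 fx by (metis IntI empty_subsetI imageI insert_subset)
  qed
  have ends: "a \<in> ?V1 \<and> b \<in> ?V1 \<or> a \<in> ?V2 \<and> b \<in> ?V2" if "(a, b) \<in> ?E" for a b
    using that mem by fastforce
  interpret one_point_union ?E ?V1 ?V2 x
  proof
    show "(u, v) \<notin> ?E \<and> (v, u) \<notin> ?E" if "u \<in> ?V1 - {x}" "v \<in> ?V2 - {x}" for u v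
      using that Int ends by blast
  qed (use Int in simp_all)
  obtain y1 where y1: "y1 \<in> pverts H1" "(x1, y1) \<in> parcs H1"
    using assms(4) by (auto simp: non_isolated_def arcs_ends_with_proj)
  obtain y2 where y2: "y2 \<in> pverts H2" "(x2, y2) \<in> parcs H2"
    using assms(5) by (auto simp: non_isolated_def arcs_ends_with_proj)
  have "f y1 \<in> ?V1" "f y1 \<noteq> x" "(x, f y1) \<in> ?E"
    using y1 E1[of x1 y1] x12 fx inj_onD[OF inj(1), of x1 y1] H1.pair_no_loops[of "(x1, y1)"] by auto
  moreover have "f y2 \<in> ?V2" "f y2 \<noteq> x" "(x, f y2) \<in> ?E"
    using y2 E2[of x2 y2] x12 fx inj_onD[OF inj(2), of x2 y2] H2.pair_no_loops[of "(x2, y2)"] by auto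
  ultimately have wb:
    "weak_bicritical_on ?E (?V1 \<union> ?V2) \<longleftrightarrow>
      (critical_on ?E ?V1 \<and> weak_bicritical_on ?E ?V2 \<and> dom_num ?E (?V2 - {x}) < dom_num ?E ?V2) \<or>
      (critical_on ?E ?V2 \<and> weak_bicritical_on ?E ?V1 \<and> dom_num ?E (?V1 - {x}) < dom_num ?E ?V1)"
    and num: "weak_bicritical_on ?E (?V1 \<union> ?V2) \<Longrightarrow>
      Suc (dom_num ?E (?V1 \<union> ?V2)) = dom_num ?E ?V1 + dom_num ?E ?V2"
    by (rule weak_bicritical_on_Un_iff)+
  have H1: "critical_on ?E ?V1 \<longleftrightarrow> critical (with_proj H1)"
    "weak_bicritical_on ?E ?V1 \<longleftrightarrow> weak_bicritical (with_proj H1)"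
    "dom_num ?E ?V1 = domination_number (with_proj H1)"
    "dom_num ?E (?V1 - {x}) < domination_number (with_proj H1) \<longleftrightarrow>
      x1 \<in> V_minus (with_proj H1)"
    using critical_on_image[OF inj(1) E1] weak_bicritical_on_image[OF inj(1) E1]
      dom_num_image[OF inj(1) E1] dom_num_image_delete[OF inj(1) E1 x12(1)] x12 fx
    by (simp_all add: critical_iff_critical_on weak_bicritical_iff_weak_bicritical_on
        domination_number_eq_dom_num V_minus_iff arcs_ends_with_proj)
  have H2: "critical_on ?E ?V2 \<longleftrightarrow> critical (with_proj H2)"
    "weak_bicritical_on ?E ?V2 \<longleftrightarrow> weak_bicritical (with_proj H2)"
    "dom_num ?E ?V2 = domination_number (with_proj H2)"
    "dom_num ?E (?V2 - {x}) < domination_number (with_proj H2) \<longleftrightarrow>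
      x2 \<in> V_minus (with_proj H2)"
    using critical_on_image[OF inj(2) E2] weak_bicritical_on_image[OF inj(2) E2]
      dom_num_image[OF inj(2) E2] dom_num_image_delete[OF inj(2) E2 x12(2)] x12 fx
    by (simp_all add: critical_iff_critical_on weak_bicritical_iff_weak_bicritical_on
        domination_number_eq_dom_num V_minus_iff arcs_ends_with_proj)
  have G: "weak_bicritical (with_proj G) \<longleftrightarrow> weak_bicritical_on ?E (?V1 \<union> ?V2)"
    "domination_number (with_proj G) = dom_num ?E (?V1 \<union> ?V2)"
    unfolding weak_bicritical_iff_weak_bicritical_on domination_number_eq_dom_num V A by simp_all
  show ?thesis
    \<comment> \<open>The successor form of the equation turns into the truncated subtraction of the
      claim.\<close>
    using wb num unfolding G H1 H2 by (metis diff_Suc_1)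
qed

end
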